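(* Let $m,n\ge1$ and $b\in[-1,1]^m$. Let $q^*$ and $q_*$ be the supervertex and subvertex of $P(b)$, and let $F:\mathcal L^n\to\mathbb R$ be a truncated $\ell$-positive function which is symmetric. Then for any $0\le k\le n$ and any $\omega\in\mathcal L^{n-k}$: (a) If $b$ is decreasing, i.e. $b(1)\ge\dots\ge b(m)$, then $$E_{q^*}(F_{\omega-})=\sum_{i_0+\dots+i_m=k}\frac{k!}{i_0!\cdots i_m!}\, b'(0)^{i_0}\cdots b'(m)^{i_m}\, F(\omega\mu_0^{i_0}\cdots\mu_m^{i_m}).$$ (b) If $q_*\in P(b)$ then $$E_{q_*}(F_{\omega-})=\sum_{i_0+\dots+i_m=k}\frac{k!}{i_0!\cdots i_m!}\, b''(0)^{i_0}\cdots b''(m)^{i_m}\, F(\omega\nu_0^{i_0}\cdots\nu_m^{i_m}).$$ The sums run over tuples of non-negative integers $(i_0,\dots,i_m)$ with sum $k$.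
   Context: Fix an integer $m\ge1$. $\mathcal L$ is the set of all functions $\lambda:\{1,\dots,m\}\to\{0,1\}$, with the convention $\lambda(0)=0$. $\mathbb R^{\mathcal L}$ is the space of functions $\mathcal L\to\mathbb R$ with standard basis $\{e_\lambda\}$ and standard inner product $\langle\ ,\ \rangle$. For $0\le i\le m$ let $\ell_i(\lambda)=(-1)^{\lambda(i)}$. For $b\in\mathbb R^m$, $P(b)=\{x\in\mathbb R^{\mathcal L}: x(\lambda)\ge 0\ \forall\lambda,\ \langle \ell_0,x\rangle=1,\ \langle \ell_i,x\rangle=b(i)\text{ for }1\le i\le m\}$, a set of probability density functions on $\mathcal L$. Truncation: $t^+=\max\{t,0\}$ for $t\in\mathbb R$, and $v^+(\lambda)=v(\lambda)^+$ for $v\in\mathbb R^{\mathcal L}$. $U_{\ell\text{-pos}}$ is the set of vectors $\sum_{i=0}^m a_i\ell_i$ with $a_1,\dots,a_m>0$ ($a_0\in\mathbb R$ arbitrary), and $(U_{\ell\text{-pos}})^+=\{\sum_{i=1}^k u_i^+ : u_i\in U_{\ell\text{-pos}},\ k\ge0\}$. Elements of $\mathcal L^k$ are regarded as words of length $k$ in the alphabet $\mathcal L$; juxtaposition is concatenation, and $\lambda^j$ denotes the word $\lambda\cdots\lambda$ of length $j$. $F:\mathcal L^n\to\mathbb R$ is symmetric if $F(\lambda_1\cdots\lambda_n)$ is independent of the order of the $\lambda_i$. It is truncated $\ell$-positive if for all words $\omega,\tau$ of total length $n-1$ the function $\lambda\mapsto F(\omega\lambda\tau)$ belongs to $(U_{\ell\text{-pos}})^+$.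 For $\omega\in\mathcal L^{n-k}$, $F_{\omega-}:\mathcal L^k\to\mathbb R$ is $F_{\omega-}(\tau)=F(\omega\tau)$. For a density $p$ on $\mathcal L$, $E_p$ of a function on $\mathcal L^k$ is the expectation with respect to the product measure $p^{\otimes k}$. For $b\in[-1,1]^m$ put $b(0)=1$, $b(m+1)=-1$. $b'(i)=\frac{b(i)-b(i+1)}2$ for $0\le i\le m$. $\mu_i\in\mathcal L$ ($0\le i\le m$): $\mu_i(k)=0$ if $k\le i$, $\mu_i(k)=1$ if $k\ge i+1$. If $b$ is decreasing the supervertex of $P(b)$ is $q^*=\sum_{i=0}^m b'(i)e_{\mu_i}$ (it is an element of $P(b)$). $\nu_i\in\mathcal L$ ($0\le i\le m$): $\nu_i(j)=1-\delta_{ij}$ for $1\le j\le m$. $b''(i)=\frac{b(i)+1}{2}$ for $1\le i\le m$ and $b''(0)=1-\sum_{i=1}^m b''(i)$. The subvertex is $q_*=\sum_{i=0}^m b''(i)e_{\nu_i}\in\mathbb R^{\mathcal L}$ (in general not in $P(b)$). Convention: $0^0=1$. *)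

theory Defs
  imports "HOL-Analysis.Analysis"
begin

type_synonym label = "nat \<Rightarrow> nat"

text \<open>A map from {1..m} to {0,1} is represented by its extension by 0 to all of nat,
  which includes the convention that a label takes the value 0 at 0.\<close>

definition labels :: "nat \<Rightarrow> label set" where
  "labels m = {l. (\<forall>i\<in>{1..m}. l i \<in> {0, 1}) \<and> l 0 = 0 \<and> (\<forall>i>m. l i = 0)}"

text \<open>Vectors indexed by the labels are functions label to real; only their values on
  \<open>labels m\<close> matter, and all conditions below are insensitive to the other values.\<close>

definition basis_vec :: "label \<Rightarrow> label \<Rightarrow> real" where
  "basis_vec l = indicator {l}"

definition inner_labels :: "nat \<Rightarrow> (label \<Rightarrow> real) \<Rightarrow> (label \<Rightarrow> real) \<Rightarrow> real" where
  "inner_labels m x y = (\<Sum>l\<in>labels m. x l * y l)"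

definition ell :: "nat \<Rightarrow> label \<Rightarrow> real" where
  "ell i l = (-1) ^ l i"

definition density_polytope :: "nat \<Rightarrow> (nat \<Rightarrow> real) \<Rightarrow> (label \<Rightarrow> real) set" where
  "density_polytope m b = {x. (\<forall>l\<in>labels m. 0 \<le> x l) \<and> inner_labels m (ell 0) x = 1 \<and>
     (\<forall>i\<in>{1..m}. inner_labels m (ell i) x = b i)}"

definition truncation :: "(label \<Rightarrow> real) \<Rightarrow> label \<Rightarrow> real" where
  "truncation v l = max (v l) 0"

definition U_ell_pos :: "nat \<Rightarrow> (label \<Rightarrow> real) set" where
  "U_ell_pos m = {u. \<exists>a :: nat \<Rightarrow> real. (\<forall>i\<in>{1..m}. 0 < a i) \<and>
     (\<forall>l\<in>labels m. u l = (\<Sum>i=0..m. a i * ell i l))}"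

definition U_ell_pos_trunc :: "nat \<Rightarrow> (label \<Rightarrow> real) set" where
  "U_ell_pos_trunc m = {v. \<exists>(k::nat) u. (\<forall>i\<in>{1..k}. u i \<in> U_ell_pos m) \<and>
     (\<forall>l\<in>labels m. v l = (\<Sum>i=1..k. truncation (u i) l))}"

definition words :: "nat \<Rightarrow> nat \<Rightarrow> label list set" where
  "words m k = {w. set w \<subseteq> labels m \<and> length w = k}"

definition symmetric_on_words :: "nat \<Rightarrow> nat \<Rightarrow> (label list \<Rightarrow> real) \<Rightarrow> bool" where
  "symmetric_on_words m n F \<longleftrightarrow>
     (\<forall>w\<in>words m n. \<forall>w'\<in>words m n. mset w = mset w' \<longrightarrow> F w = F w')"

definition truncated_ell_positive :: "nat \<Rightarrow> nat \<Rightarrow> (label list \<Rightarrow> real) \<Rightarrow> bool" where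
  "truncated_ell_positive m n F \<longleftrightarrow>
     (\<forall>\<omega> \<tau>. set \<omega> \<subseteq> labels m \<and> set \<tau> \<subseteq> labels m \<and> length \<omega> + length \<tau> + 1 = n \<longrightarrow>
        (\<lambda>l. F (\<omega> @ [l] @ \<tau>)) \<in> U_ell_pos_trunc m)"

definition prefixed :: "(label list \<Rightarrow> real) \<Rightarrow> label list \<Rightarrow> label list \<Rightarrow> real" where
  "prefixed F \<omega> \<tau> = F (\<omega> @ \<tau>)"

text \<open>The expectation of a function of words of length k under the k-fold product of the
  measure with density p with respect to counting measure on the labels. A point f of the
  product space stands for the word f 0, ..., f (k - 1). Since \<open>ennreal\<close> cuts off
  negative values, this is meaningful only for p that is nonnegative on the labels.\<close>

definition expectation :: "nat \<Rightarrow> nat \<Rightarrow> (label \<Rightarrow> real) \<Rightarrow> (label list \<Rightarrow> real) \<Rightarrow> real" where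
  "expectation m k p G =
     (\<integral>f. G (map f [0..<k]) \<partial>(\<Pi>\<^sub>M j\<in>{..<k}. point_measure (labels m) (\<lambda>l. ennreal (p l))))"

definition extend_b :: "nat \<Rightarrow> (nat \<Rightarrow> real) \<Rightarrow> nat \<Rightarrow> real" where
  "extend_b m b i = (if i = 0 then 1 else if i = m + 1 then -1 else b i)"

definition b_super :: "nat \<Rightarrow> (nat \<Rightarrow> real) \<Rightarrow> nat \<Rightarrow> real" where
  "b_super m b i = (extend_b m b i - extend_b m b (i + 1)) / 2"

definition mu :: "nat \<Rightarrow> nat \<Rightarrow> label" where
  "mu m i k = (if i + 1 \<le> k \<and> k \<le> m then 1 else 0)"

definition supervertex :: "nat \<Rightarrow> (nat \<Rightarrow> real) \<Rightarrow> label \<Rightarrow> real" where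
  "supervertex m b l = (\<Sum>i=0..m. b_super m b i * basis_vec (mu m i) l)"

definition b_sub :: "nat \<Rightarrow> (nat \<Rightarrow> real) \<Rightarrow> nat \<Rightarrow> real" where
  "b_sub m b i = (if i = 0 then 1 - (\<Sum>j=1..m. (b j + 1) / 2) else (b i + 1) / 2)"

definition nu :: "nat \<Rightarrow> nat \<Rightarrow> label" where
  "nu m i j = (if 1 \<le> j \<and> j \<le> m \<and> j \<noteq> i then 1 else 0)"

definition subvertex :: "nat \<Rightarrow> (nat \<Rightarrow> real) \<Rightarrow> label \<Rightarrow> real" where
  "subvertex m b l = (\<Sum>i=0..m. b_sub m b i * basis_vec (nu m i) l)"

definition index_tuples :: "nat \<Rightarrow> nat \<Rightarrow> (nat \<Rightarrow> nat) set" where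
  "index_tuples m k = {i \<in> {0..m} \<rightarrow>\<^sub>E UNIV. (\<Sum>j=0..m. i j) = k}"

definition power_word :: "nat \<Rightarrow> (nat \<Rightarrow> label) \<Rightarrow> (nat \<Rightarrow> nat) \<Rightarrow> label list" where
  "power_word m v i = concat (map (\<lambda>j. replicate (i j) (v j)) [0..<m + 1])"

end

theory Submission
  imports Defs "HOL-Combinatorics.Multiset_Permutations"
begin

text \<open>The supervertex and the subvertex are nonnegative combinations \<open>\<Sum>\<^sub>i c\<^sub>i e\<^bsub>v\<^sub>i\<^esub>\<close> with distinct
  labels \<open>v\<^sub>0, \<dots>, v\<^sub>m\<close>, so the expectation is a finite sum over words in the alphabet
  \<open>v\<^sub>0, \<dots>, v\<^sub>m\<close>. By symmetry of F the summand depends only on the letter counts of the word, and the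
  number of words with given letter counts is a multinomial coefficient.\<close>

section \<open>Expectations as finite sums over words\<close>

text \<open>The product space is the finite set \<open>I \<rightarrow>\<^sub>E A\<close>, so
  \<open>G\<close> agrees on it with a finite combination of indicators of singletons. Linearity
  then leaves only the mass of each singleton, which is a product of values of
  \<open>p\<close>.\<close>

lemma integral_PiM_point_measure:
  fixes G :: "('i \<Rightarrow> 'a) \<Rightarrow> real" and p :: "'a \<Rightarrow> real"
  assumes I: "finite I" and A: "finite A" and p: "\<And>a. a \<in> A \<Longrightarrow> 0 \<le> p a"
  shows "(\<integral>f. G f \<partial>(\<Pi>\<^sub>M i\<in>I. point_measure A (\<lambda>a. ennreal (p a)))) =
         (\<Sum>f\<in>I \<rightarrow>\<^sub>E A. (\<Prod>i\<in>I. p (f i)) * G f)"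
proof -
  let ?P = "point_measure A (\<lambda>a. ennreal (p a))"
  let ?M = "\<Pi>\<^sub>M i\<in>I. ?P"
  interpret finite_measure ?P
    by (rule finite_measureI) (simp add: space_point_measure emeasure_point_measure_finite A)
  interpret product_sigma_finite "\<lambda>_::'i. ?P" ..
  have sp: "space ?M = I \<rightarrow>\<^sub>E A"
    by (simp add: space_PiM space_point_measure)
  have fin: "finite (I \<rightarrow>\<^sub>E A)"
    using I A by (rule finite_PiE)
  \<comment> \<open>Seen as a box, a singleton is measurable and its mass is given by the product
    formula \<open>emeasure_PiM\<close>.\<close>
  have single: "{f} = (\<Pi>\<^sub>E i\<in>I. {f i})" if "f \<in> I \<rightarrow>\<^sub>E A" for f
    using that by (intro PiE_singleton[symmetric]) (simp add: PiE_def)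
  have sets: "{f i} \<in> sets ?P" if "f \<in> I \<rightarrow>\<^sub>E A" "i \<in> I" for f i
    using that by (auto simp: sets_point_measure)
  have sets': "{f} \<in> sets ?M" if "f \<in> I \<rightarrow>\<^sub>E A" for f
    unfolding single[OF that] using I sets[OF that] by (intro sets_PiM_I_finite) auto
  have em: "emeasure ?M {f} = ennreal (\<Prod>i\<in>I. p (f i))" if f: "f \<in> I \<rightarrow>\<^sub>E A" for f
  proof -
    have "emeasure ?M {f} = (\<Prod>i\<in>I. emeasure ?P {f i})"
      unfolding single[OF f] using I sets[OF f] by (rule emeasure_PiM)
    also have "\<dots> = (\<Prod>i\<in>I. ennreal (p (f i)))"
      using f by (intro prod.cong refl, subst emeasure_point_measure_finite) (auto simp: A)
    also have "\<dots> = ennreal (\<Prod>i\<in>I. p (f i))"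
      using f p by (intro prod_ennreal) auto
    finally show ?thesis .
  qed
  have "(\<integral>f. G f \<partial>?M) = (\<integral>f. (\<Sum>g\<in>I \<rightarrow>\<^sub>E A. indicator {g} f * G g) \<partial>?M)"
  proof (rule Bochner_Integration.integral_cong[OF refl])
    fix f assume "f \<in> space ?M"
    then have f: "f \<in> I \<rightarrow>\<^sub>E A" by (simp only: sp)
    have "(\<Sum>g\<in>I \<rightarrow>\<^sub>E A. indicator {g} f * G g) = (\<Sum>g\<in>{f}. indicator {g} f * G g)"
      using f fin by (intro sum.mono_neutral_right) auto
    then show "G f = (\<Sum>g\<in>I \<rightarrow>\<^sub>E A. indicator {g} f * G g)" by simp
  qed
  also have "\<dots> = (\<Sum>g\<in>I \<rightarrow>\<^sub>E A. \<integral>f. indicator {g} f * G g \<partial>?M)"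
    using sets' by (intro Bochner_Integration.integral_sum integrable_mult_left
        integrable_real_indicator) (auto simp: em)
  also have "\<dots> = (\<Sum>g\<in>I \<rightarrow>\<^sub>E A. (\<Prod>i\<in>I. p (g i)) * G g)"
  proof (rule sum.cong[OF refl])
    fix g assume g: "g \<in> I \<rightarrow>\<^sub>E A"
    have "measure ?M {g} = (\<Prod>i\<in>I. p (g i))"
      using g p by (subst measure_def, subst em[OF g]) (auto intro!: enn2real_ennreal prod_nonneg)
    moreover have "{g} \<inter> space ?M = {g}"
      using g by (simp add: sp)
    ultimately show "(\<integral>f. indicator {g} f * G g \<partial>?M) = (\<Prod>i\<in>I. p (g i)) * G g"
      by simp
  qed
  finally show ?thesis .
qed

lemma finite_labels: "finite (labels m)"
proof (rule finite_subset)
  \<comment> \<open>A label is the indicator function of the set of positions where it equals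
    1.\<close>
  show "labels m \<subseteq> (\<lambda>S i. if i \<in> S then 1 else 0) ` Pow {1..m}"
  proof
    fix l assume l: "l \<in> labels m"
    have "l i = (if i \<in> {i \<in> {1..m}. l i = 1} then 1 else 0)" for i
    proof (cases "i \<in> {1..m}")
      case True
      then show ?thesis using l by (auto simp: labels_def)
    next
      case False
      then have "i = 0 \<or> i > m" by auto
      then show ?thesis using l False by (auto simp: labels_def)
    qed
    then have "l = (\<lambda>S i. if i \<in> S then 1 else 0) {i \<in> {1..m}. l i = 1}"
      by blast
    then show "l \<in> (\<lambda>S i. if i \<in> S then 1 else 0) ` Pow {1..m}"
      by blast
  qed
qed simp

lemma finite_words: "finite (words m k)"
  unfolding words_def using finite_labels by (rule finite_lists_length_eq)

text \<open>Points of the product space and words of length \<open>k\<close> correspond via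
  \<open>map f [0..<k]\<close>. Nonnegativity of \<open>p\<close> ensures that
  \<open>ennreal\<close> does not alter the density.\<close>

lemma expectation_eq_sum_words:
  assumes "\<And>l. l \<in> labels m \<Longrightarrow> 0 \<le> p l"
  shows "expectation m k p G = (\<Sum>w\<in>words m k. prod_list (map p w) * G w)"
proof -
  have "expectation m k p G =
      (\<Sum>f\<in>{..<k} \<rightarrow>\<^sub>E labels m. (\<Prod>j<k. p (f j)) * G (map f [0..<k]))"
    unfolding expectation_def using finite_labels assms by (intro integral_PiM_point_measure) auto
  also have "\<dots> = (\<Sum>w\<in>words m k. prod_list (map p w) * G w)"
  \<comment> \<open>The inverse sends a word to its indexing function, restricted because elements
    of the product space are extensional.\<close>
  proof (rule sum.reindex_bij_witness[where i = "\<lambda>w. restrict ((!) w) {..<k}"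
        and j = "\<lambda>f. map f [0..<k]"])
    fix f assume f: "f \<in> {..<k} \<rightarrow>\<^sub>E labels m"
    show "restrict ((!) (map f [0..<k])) {..<k} = f"
      using f by (auto simp: PiE_iff extensional_def restrict_def)
    show "map f [0..<k] \<in> words m k"
      using f by (simp add: words_def image_subset_iff PiE_iff)
    show "prod_list (map p (map f [0..<k])) * G (map f [0..<k]) =
        (\<Prod>j<k. p (f j)) * G (map f [0..<k])"
      by (simp add: prod.list_conv_set_nth lessThan_atLeast0)
  next
    fix w assume w: "w \<in> words m k"
    then have len: "length w = k" by (simp add: words_def)
    show "map (restrict ((!) w) {..<k}) [0..<k] = w"
      by (rule nth_equalityI) (simp_all add: len)
    show "restrict ((!) w) {..<k} \<in> {..<k} \<rightarrow>\<^sub>E labels m"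
      using w by (auto simp: words_def)
  qed
  finally show ?thesis .
qed

section \<open>Densities supported on finitely many distinct labels\<close>

lemma basis_combination_at:
  fixes v :: "nat \<Rightarrow> label"
  assumes inj: "inj_on v {0..m}" and i: "i \<in> {0..m}"
  shows "(\<Sum>j=0..m. c j * basis_vec (v j) (v i)) = c i"
proof -
  have "(\<Sum>j=0..m. c j * basis_vec (v j) (v i)) = (\<Sum>j=0..m. if j = i then c j else 0)"
    using inj i by (intro sum.cong refl) (auto simp: basis_vec_def indicator_def inj_on_def)
  also have "\<dots> = c i"
    using i by simp
  finally show ?thesis .
qed

lemma expectation_basis_combination:
  fixes v :: "nat \<Rightarrow> label"
  assumes inj: "inj_on v {0..m}" and v: "v ` {0..m} \<subseteq> labels m"
    and c: "\<And>i. i \<in> {0..m} \<Longrightarrow> 0 \<le> c i"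
  shows "expectation m k (\<lambda>l. \<Sum>i=0..m. c i * basis_vec (v i) l) G =
    (\<Sum>xs | set xs \<subseteq> {0..m} \<and> length xs = k. prod_list (map c xs) * G (map v xs))"
proof -
  let ?p = "\<lambda>l. \<Sum>i=0..m. c i * basis_vec (v i) l"
  let ?X = "{xs. set xs \<subseteq> {0..m} \<and> length xs = k}"
  have p_off: "?p l = 0" if "l \<notin> v ` {0..m}" for l
    using that by (intro sum.neutral) (auto simp: basis_vec_def indicator_def)
  have sub: "map v ` ?X \<subseteq> words m k"
    using v by (fastforce simp: words_def)
  have inj_map: "inj_on (map v) ?X"
    using inj by (auto simp: inj_on_def intro!: map_inj_on[where f = v] intro: inj_on_subset[of v "{0..m}"])
  have "expectation m k ?p G = (\<Sum>w\<in>words m k. prod_list (map ?p w) * G w)"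
    using c by (intro expectation_eq_sum_words sum_nonneg) (auto simp: basis_vec_def)
  also have "\<dots> = (\<Sum>w\<in>map v ` ?X. prod_list (map ?p w) * G w)"
  proof (rule sum.mono_neutral_right[OF finite_words sub], rule ballI)
    fix w assume w: "w \<in> words m k - map v ` ?X"
    have "\<not> set w \<subseteq> v ` {0..m}"
    proof
      assume "set w \<subseteq> v ` {0..m}"
      then have "w \<in> map v ` lists {0..m}"
        by (simp add: lists_image[symmetric] in_lists_conv_set subset_iff)
      with w show False by (auto simp: words_def lists_eq_set)
    qed
    then obtain l where "l \<in> set w" "?p l = 0"
      using p_off by blast
    then have "prod_list (map ?p w) = 0"
      by (force simp: prod_list_zero_iff)
    then show "prod_list (map ?p w) * G w = 0" by simp
  qed
  also have "\<dots> = (\<Sum>xs\<in>?X. prod_list (map ?p (map v xs)) * G (map v xs))"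
    by (subst sum.reindex[OF inj_map]) simp
  also have "\<dots> = (\<Sum>xs\<in>?X. prod_list (map c xs) * G (map v xs))"
  proof (rule sum.cong[OF refl])
    fix xs assume "xs \<in> ?X"
    then have "map ?p (map v xs) = map c xs"
      using basis_combination_at[OF inj] by auto
    then show "prod_list (map ?p (map v xs)) * G (map v xs) = prod_list (map c xs) * G (map v xs)"
      by (simp only:)
  qed
  finally show ?thesis .
qed

section \<open>Counting words with given letter counts\<close>

text \<open>The counterpart of \<open>power_word\<close> over the alphabet of indices: the sorted
  representative of all words with letter counts \<open>i\<close>. It lets the counting take place
  before labels enter.\<close>

definition index_word :: "nat \<Rightarrow> (nat \<Rightarrow> nat) \<Rightarrow> nat list" where
  "index_word m i = concat (map (\<lambda>j. replicate (i j) j) [0..<m + 1])"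

lemma power_word_eq_map: "power_word m v i = map v (index_word m i)"
  unfolding power_word_def index_word_def by (simp only: map_concat map_map o_def map_replicate id_apply)

lemma count_index_word:
  "count (mset (index_word m i)) j = (if j \<le> m then i j else 0)"
proof -
  have "count (mset (index_word m i)) j = (\<Sum>a\<in>{0..<m+1}. if a = j then i a else 0)"
    by (simp add: index_word_def mset_concat o_def sum_list_sum_nth count_sum
        interv_sum_list_conv_sum_set_nat del: upt_Suc cong: if_cong)
  also have "\<dots> = (if j \<le> m then i j else 0)"
    by (simp add: less_Suc_eq_le)
  finally show ?thesis .
qed

text \<open>This is the multinomial coefficient. Letters of \<open>S\<close> absent from
  \<open>M\<close> contribute the factor 0! = 1, so the product can run over a fixed
  alphabet.\<close>

lemma real_card_permutations_of_multiset:
  assumes "finite S" "set_mset M \<subseteq> S"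
  shows "real (card (permutations_of_multiset M)) = fact (size M) / (\<Prod>x\<in>S. fact (count M x))"
proof -
  have "(\<Prod>x\<in>S. fact (count M x) :: nat) = (\<Prod>x\<in>set_mset M. fact (count M x))"
    using assms by (intro prod.mono_neutral_right) (auto simp: not_in_iff)
  then have "card (permutations_of_multiset M) * (\<Prod>x\<in>S. fact (count M x)) = fact (size M)"
    by (simp only: card_permutations_of_multiset_aux)
  from arg_cong[OF this, of real] show ?thesis
    using assms by (simp add: eq_divide_eq)
qed

text \<open>Words are grouped by their letter counts. The words with counts \<open>i\<close> are the
  rearrangements of \<open>index_word m i\<close>; the summand is constant on them, and their number
  is the multinomial coefficient.\<close>

lemma sum_words_by_counts:
  fixes c :: "nat \<Rightarrow> real" and G :: "nat list \<Rightarrow> real"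
  assumes sym: "\<And>xs ys. set xs \<subseteq> {0..m} \<Longrightarrow> length xs = k \<Longrightarrow> mset xs = mset ys \<Longrightarrow> G xs = G ys"
  shows "(\<Sum>xs | set xs \<subseteq> {0..m} \<and> length xs = k. prod_list (map c xs) * G xs) =
    (\<Sum>i\<in>index_tuples m k. fact k / (\<Prod>j=0..m. fact (i j)) * (\<Prod>j=0..m. c j ^ i j) *
       G (index_word m i))"
proof -
  let ?X = "{xs. set xs \<subseteq> {0..m} \<and> length xs = k}"
  \<comment> \<open>The restriction makes the count function extensional, as membership in
    \<open>index_tuples\<close> demands.\<close>
  define g where "g xs = restrict (count (mset xs)) {0..m}" for xs :: "nat list"
  have size: "length xs = (\<Sum>j=0..m. count (mset xs) j)" if "set xs \<subseteq> {0..m}" for xs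
  proof -
    have "length xs = (\<Sum>j\<in>set_mset (mset xs). count (mset xs) j)"
      by (metis size_mset size_multiset_overloaded_eq)
    also have "\<dots> = (\<Sum>j=0..m. count (mset xs) j)"
      using that by (intro sum.mono_neutral_left) (auto simp: not_in_iff count_eq_zero_iff)
    finally show ?thesis .
  qed
  have set_pw: "set (index_word m i) \<subseteq> {0..m}" for i
    by (auto simp: index_word_def)
  have finX: "finite ?X"
    by (rule finite_lists_length_eq) simp
  have finT: "finite (index_tuples m k)"
  proof (rule finite_subset)
    show "index_tuples m k \<subseteq> {0..m} \<rightarrow>\<^sub>E {..k}"
    proof
      fix i assume i: "i \<in> index_tuples m k"
      have "i j \<le> k" if "j \<in> {0..m}" for j
        using i that member_le_sum[of j "{0..m}" i] by (auto simp: index_tuples_def)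
      then show "i \<in> {0..m} \<rightarrow>\<^sub>E {..k}"
        using i by (auto simp: index_tuples_def PiE_iff)
    qed
  qed (simp add: finite_PiE)
  have gX: "g ` ?X \<subseteq> index_tuples m k"
    using size by (auto simp: g_def index_tuples_def)
  have fiber: "{xs \<in> ?X. g xs = i} = permutations_of_multiset (mset (index_word m i))"
    (is "?L = ?R") if i: "i \<in> index_tuples m k" for i
  proof
    show "?L \<subseteq> ?R"
    proof
      fix xs assume xs: "xs \<in> ?L"
      \<comment> \<open>The equation \<open>g xs = i\<close> gives the counts up to
        \<open>m\<close>; larger indices do not occur in \<open>xs\<close>.\<close>
      have "count (mset xs) j = (if j \<le> m then i j else 0)" for j
        using xs by (auto simp: g_def restrict_def subset_iff count_eq_zero_iff not_in_iff)
      then show "xs \<in> ?R"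
        by (intro permutations_of_multisetI multiset_eqI) (simp add: count_index_word)
    qed
    show "?R \<subseteq> ?L"
    proof
      fix xs assume "xs \<in> ?R"
      then have m: "mset xs = mset (index_word m i)"
        by (rule permutations_of_multisetD)
      have s: "set xs \<subseteq> {0..m}"
        using set_pw[of i] mset_eq_setD[OF m] by simp
      have "g xs = i"
        using i by (auto simp: g_def m count_index_word index_tuples_def PiE_iff
            extensional_def fun_eq_iff restrict_def)
      moreover have "length xs = k"
        using i size[OF s] by (simp add: m count_index_word index_tuples_def)
      ultimately show "xs \<in> ?L"
        using s by simp
    qed
  qed
  have "(\<Sum>xs\<in>?X. prod_list (map c xs) * G xs) =
      (\<Sum>i\<in>index_tuples m k. \<Sum>xs | xs \<in> ?X \<and> g xs = i. prod_list (map c xs) * G xs)"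
    using finX finT gX by (rule sum.group[symmetric])
  also have "\<dots> = (\<Sum>i\<in>index_tuples m k. fact k / (\<Prod>j=0..m. fact (i j)) *
      (\<Prod>j=0..m. c j ^ i j) * G (index_word m i))"
  proof (rule sum.cong[OF refl])
    fix i assume i: "i \<in> index_tuples m k"
    let ?M = "mset (index_word m i)"
    have "(\<Sum>xs | xs \<in> ?X \<and> g xs = i. prod_list (map c xs) * G xs) =
        (\<Sum>xs\<in>permutations_of_multiset ?M. (\<Prod>j=0..m. c j ^ i j) * G (index_word m i))"
      unfolding fiber[OF i]
    proof (rule sum.cong[OF refl])
      fix xs assume xs: "xs \<in> permutations_of_multiset ?M"
      then have m: "mset xs = ?M"
        by (rule permutations_of_multisetD)
      have X: "set xs \<subseteq> {0..m}" "length xs = k"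
        using xs unfolding fiber[OF i, symmetric] by auto
      have "prod_list (map c xs) = prod_mset (image_mset c ?M)"
        by (simp add: prod_mset_prod_list[symmetric] m[symmetric])
      also have "\<dots> = (\<Prod>j\<in>set_mset ?M. c j ^ count ?M j)"
        by (rule image_prod_mset_multiplicity)
      \<comment> \<open>An index absent from the word has exponent 0 and contributes 1, also when
        \<open>c j = 0\<close>: here the convention 0^0 = 1 enters.\<close>
      also have "\<dots> = (\<Prod>j=0..m. c j ^ count ?M j)"
        using set_pw[of i] by (intro prod.mono_neutral_left) (auto simp: count_mset_0_iff[THEN iffD2])
      also have "\<dots> = (\<Prod>j=0..m. c j ^ i j)"
        by (intro prod.cong) (auto simp: count_index_word)
      finally show "prod_list (map c xs) * G xs = (\<Prod>j=0..m. c j ^ i j) * G (index_word m i)"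
        using sym[OF X m] by simp
    qed
    also have "\<dots> = real (card (permutations_of_multiset ?M)) *
        ((\<Prod>j=0..m. c j ^ i j) * G (index_word m i))"
      by simp
    also have "real (card (permutations_of_multiset ?M)) = fact k / (\<Prod>j=0..m. fact (i j))"
    proof -
      have "size ?M = k"
        using i size[OF set_pw[of i]] by (simp add: count_index_word index_tuples_def)
      moreover have "(\<Prod>j=0..m. fact (count ?M j)) = (\<Prod>j=0..m. fact (i j) :: real)"
        by (intro prod.cong) (auto simp: count_index_word)
      moreover have "set_mset ?M \<subseteq> {0..m}"
        using set_pw[of i] by simp
      ultimately show ?thesis
        using real_card_permutations_of_multiset[of "{0..m}" ?M] by simp
    qed
    finally show "(\<Sum>xs | xs \<in> ?X \<and> g xs = i. prod_list (map c xs) * G xs) =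
        fact k / (\<Prod>j=0..m. fact (i j)) * (\<Prod>j=0..m. c j ^ i j) * G (index_word m i)"
      by (simp only: mult.assoc)
  qed
  finally show ?thesis .
qed

text \<open>This is the common form of both claims. Rearranging the last \<open>k\<close> letters of
  a word of length \<open>n\<close> with prefix \<open>\<omega>\<close> preserves its multiset of
  letters, so symmetry of \<open>F\<close> makes the value depend on letter counts alone.\<close>

lemma expectation_prefixed_basis_combination:
  assumes sym: "symmetric_on_words m n F" and "k \<le> n" and \<omega>: "\<omega> \<in> words m (n - k)"
    and inj: "inj_on v {0..m}" and v: "v ` {0..m} \<subseteq> labels m"
    and c: "\<And>i. i \<in> {0..m} \<Longrightarrow> 0 \<le> c i"
  shows "expectation m k (\<lambda>l. \<Sum>i=0..m. c i * basis_vec (v i) l) (prefixed F \<omega>) =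
    (\<Sum>i\<in>index_tuples m k. fact k / (\<Prod>j=0..m. fact (i j)) * (\<Prod>j=0..m. c j ^ i j) *
       F (\<omega> @ power_word m v i))"
proof -
  have "F (\<omega> @ map v xs) = F (\<omega> @ map v ys)"
    if "set xs \<subseteq> {0..m}" "length xs = k" "mset xs = mset ys" for xs ys
  proof -
    have "set ys \<subseteq> {0..m}" "length ys = k"
      using that mset_eq_setD[OF that(3)] mset_eq_length[OF that(3)] by auto
    then have "\<omega> @ map v xs \<in> words m n" "\<omega> @ map v ys \<in> words m n"
      using that \<omega> v \<open>k \<le> n\<close> by (auto simp: words_def image_subset_iff subset_iff)
    moreover have "mset (\<omega> @ map v xs) = mset (\<omega> @ map v ys)"
      using that by simp
    ultimately show ?thesis
      using sym unfolding symmetric_on_words_def by blast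
  qed
  from sum_words_by_counts[of m k "\<lambda>xs. F (\<omega> @ map v xs)" c, OF this]
  show ?thesis
    by (simp only: expectation_basis_combination[OF inj v c] prefixed_def
        power_word_eq_map[of m v])
qed

section \<open>The labels and weights of the two vertices\<close>

lemma inj_on_mu: "inj_on (mu m) {0..m}"
proof (rule linorder_inj_onI)
  fix i j assume "i < j" "i \<in> {0..m}" "j \<in> {0..m}"
  \<comment> \<open>The larger index separates the two labels: at \<open>j\<close> the first is 1
    and the second is 0.\<close>
  then have "mu m i j \<noteq> mu m j j"
    by (simp add: mu_def)
  then show "mu m i \<noteq> mu m j" by auto
qed auto

lemma inj_on_nu: "inj_on (nu m) {0..m}"
proof (rule linorder_inj_onI)
  fix i j assume "i < j" "i \<in> {0..m}" "j \<in> {0..m}"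
  \<comment> \<open>Again the values at \<open>j\<close> are 1 and 0; \<open>j\<close> is a genuine
    position because \<open>i < j\<close> forces it to be at least 1.\<close>
  then have "nu m i j \<noteq> nu m j j"
    by (simp add: nu_def)
  then show "nu m i \<noteq> nu m j" by auto
qed auto

lemma mu_in_labels: "mu m i \<in> labels m"
  by (auto simp: labels_def mu_def)

lemma nu_in_labels: "nu m i \<in> labels m"
  by (auto simp: labels_def nu_def)

text \<open>Interior weights are half the drops of a decreasing sequence. The two end weights use
  the boundary values 1 and -1 together with the range of \<open>b\<close>.\<close>

lemma b_super_nonneg:
  assumes "\<forall>i\<in>{1..m}. b i \<in> {-1..1}" "antimono_on {1..m} b" "i \<in> {0..m}"
  shows "0 \<le> b_super m b i"
proof -
  have "b (i + 1) \<le> b i" if "1 \<le> i" "i < m"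
    using monotone_onD[OF assms(2), of i "i + 1"] that by simp
  moreover have "0 \<le> b m + 1" "b 1 \<le> 1" if "1 \<le> m"
    using bspec[OF assms(1), of m] bspec[OF assms(1), of 1] that by auto
  ultimately show ?thesis
    using assms(3) by (cases "i = 0"; cases "i = m") (auto simp: b_super_def extend_b_def)
qed

text \<open>By distinctness of the labels, the weights are themselves values of the subvertex, and
  elements of the polytope are nonnegative. This matters for \<open>b_sub m b 0\<close>, which can
  be negative for general \<open>b\<close>.\<close>

lemma b_sub_nonneg:
  assumes "subvertex m b \<in> density_polytope m b" "i \<in> {0..m}"
  shows "0 \<le> b_sub m b i"
proof -
  have "subvertex m b (nu m i) = b_sub m b i"
    unfolding subvertex_def using inj_on_nu assms(2) by (rule basis_combination_at)
  then show ?thesis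
    using assms(1) nu_in_labels[of m i] by (auto simp: density_polytope_def)
qed

theorem proposition1p11:
  fixes m n k :: nat
    and b :: "nat \<Rightarrow> real"
    and F :: "label list \<Rightarrow> real"
    and \<omega> :: "label list"
  assumes "1 \<le> m" and "1 \<le> n"
    and "\<forall>i\<in>{1..m}. b i \<in> {-1..1}"
    and "truncated_ell_positive m n F"
    and "symmetric_on_words m n F"
    and "k \<le> n"
    and "\<omega> \<in> words m (n - k)"
  shows "(antimono_on {1..m} b \<longrightarrow>
      expectation m k (supervertex m b) (prefixed F \<omega>) =
        (\<Sum>i\<in>index_tuples m k. fact k / (\<Prod>j=0..m. fact (i j)) *
           (\<Prod>j=0..m. b_super m b j ^ i j) * F (\<omega> @ power_word m (mu m) i)))
    \<and> (subvertex m b \<in> density_polytope m b \<longrightarrow>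
      expectation m k (subvertex m b) (prefixed F \<omega>) =
        (\<Sum>i\<in>index_tuples m k. fact k / (\<Prod>j=0..m. fact (i j)) *
           (\<Prod>j=0..m. b_sub m b j ^ i j) * F (\<omega> @ power_word m (nu m) i)))"
proof (intro conjI impI)
  \<comment> \<open>Both claims instantiate the same formula, with weights
    \<open>b_super m b\<close> and labels \<open>mu m\<close> here, and with
    \<open>b_sub m b\<close> and \<open>nu m\<close> below.\<close>
  assume "antimono_on {1..m} b"
  with assms show "expectation m k (supervertex m b) (prefixed F \<omega>) =
        (\<Sum>i\<in>index_tuples m k. fact k / (\<Prod>j=0..m. fact (i j)) *
           (\<Prod>j=0..m. b_super m b j ^ i j) * F (\<omega> @ power_word m (mu m) i))"
    unfolding supervertex_def[abs_def]
    by (intro expectation_prefixed_basis_combination[where n = n] inj_on_mu b_super_nonneg)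
      (auto simp: mu_in_labels)
next
  assume "subvertex m b \<in> density_polytope m b"
  then have "0 \<le> b_sub m b i" if "i \<in> {0..m}" for i
    using that by (rule b_sub_nonneg)
  with assms show "expectation m k (subvertex m b) (prefixed F \<omega>) =
        (\<Sum>i\<in>index_tuples m k. fact k / (\<Prod>j=0..m. fact (i j)) *
           (\<Prod>j=0..m. b_sub m b j ^ i j) * F (\<omega> @ power_word m (nu m) i))"
    unfolding subvertex_def[abs_def]
    by (intro expectation_prefixed_basis_combination[where n = n] inj_on_nu)
      (auto simp: nu_in_labels)
qed

end
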